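(* Let $V=\bigoplus_{n\in\mathbb{Z}}V_n$ be a $\mathbb{Z}$-graded vertex algebra over $\mathbb{K}$, and suppose that $V$ admits another $\mathbb{Z}$-grading $V=\bigoplus_{n\in\mathbb{Z}}V'_n$ making it a $\mathbb{Z}$-graded vertex algebra. If $V'_n\subset V_{\ge n}$ for all $n\in\mathbb{Z}$, then there exists a vertex algebra homomorphism $\psi:V\to V$ such that $\psi(V'_n)\subset V_n$ for all $n\in\mathbb{Z}$. Furthermore, if $V'_n\subset V_{\ge n}$ and $V_n\subset V'_{\ge n}$ for all $n\in\mathbb{Z}$, then there exists $\psi\in\mathrm{Aut}^{+}V$ such that $\psi(V_n)=V'_n$ for all $n\in\mathbb{Z}$.
   Context: The base field $\mathbb{K}$ is $\mathbb{R}$ or $\mathbb{C}$. For a vertex algebra $V$ with vacuum vector $\mathbf{1}$, $a(n)b$ denotes the $n$-th product ($n\in\mathbb{Z}$). A $\mathbb{Z}$-graded vertex algebra is a vertex algebra that is a direct sum $V=\bigoplus_{n\in\mathbb{Z}}V_n$ of vector spaces with $V_n(k)V_m\subset V_{n+m-k-1}$ and $\mathbf{1}\in V_0$. Put $V_{\ge n}=\bigoplus_{i\ge n}V_i$ and $V'_{\ge n}=\bigoplus_{i\ge n}V'_i$, and let $\mathrm{pr}_n:\bigoplus_i V_i\to V_n$ be the canonical projection. $\mathrm{Aut}\,V$ is the group of vertex algebra automorphisms (linear isomorphisms $f$ with $f(a(n)b)=f(a)(n)f(b)$ and $f(\mathbf{1})=\mathbf{1}$), and $\mathrm{Aut}^{+}V=\{f\in\mathrm{Aut}\,V\mid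 f(V_n)\subset V_{\ge n}\text{ and }\mathrm{pr}_n\circ f|_{V_n}=\mathrm{id}_{V_n}\text{ for all }n\in\mathbb{Z}\}$ (with respect to the grading $V=\bigoplus V_n$). *)

theory Defs
  imports Complex_Main "HOL-Library.Groups_Big_Fun"
begin

text \<open>The base field is \<open>\<real>\<close> or \<open>\<complex>\<close>: a condition on the scalar type, up to
  isomorphism of fields.\<close>

definition field_iso :: "('a::field \<Rightarrow> 'b::field) \<Rightarrow> bool" where
  "field_iso f \<longleftrightarrow> bij f \<and> f 1 = 1 \<and> (\<forall>x y. f (x + y) = f x + f y) \<and> (\<forall>x y. f (x * y) = f x * f y)"

definition real_or_complex :: "'k::field itself \<Rightarrow> bool" where
  "real_or_complex _ \<longleftrightarrow> (\<exists>f :: 'k \<Rightarrow> real. field_iso f) \<or> (\<exists>f :: 'k \<Rightarrow> complex. field_iso f)"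

lemma real_or_complex_real: "real_or_complex TYPE(real)"
  unfolding real_or_complex_def field_iso_def by (intro disjI1 exI[of _ id]) simp

lemma real_or_complex_complex: "real_or_complex TYPE(complex)"
  unfolding real_or_complex_def field_iso_def by (intro disjI2 exI[of _ id]) simp

text \<open>The underlying vector space is the whole type \<open>'v\<close>, and \<open>prd a n b\<close> is the \<open>n\<close>-th product
  \<open>a(n)b\<close>. \<open>Sum_any\<close> is the sum over the support, which is finite in both sums of the Borcherds
  identity because of \<open>truncation\<close> (see the lemmas below).\<close>

locale vertex_algebra = vector_space scale
  for scale :: "'k::field_char_0 \<Rightarrow> 'v::ab_group_add \<Rightarrow> 'v" +
  fixes vac :: 'v
    and prd :: "'v \<Rightarrow> int \<Rightarrow> 'v \<Rightarrow> 'v"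
  assumes linear_left: "Vector_Spaces.linear scale scale (\<lambda>a. prd a n b)"
    and linear_right: "Vector_Spaces.linear scale scale (\<lambda>b. prd a n b)"
    and truncation: "\<exists>N. \<forall>n\<ge>N. prd a n b = 0"
    and vac_left: "prd vac n a = (if n = -1 then a else 0)"
    and vac_right_nonneg: "n \<ge> 0 \<Longrightarrow> prd a n vac = 0"
    and vac_right_creation: "prd a (-1) vac = a"
    and borcherds: "\<And>(p::int) (q::int) (r::int) (a::'v) (b::'v) (c::'v).
       Sum_any (\<lambda>i::nat. scale (of_int p gchoose i)
          (prd (prd a (r + int i) b) (p + q - int i) c)) =
       Sum_any (\<lambda>i::nat. scale ((-1) ^ i * (of_int r gchoose i))
          (prd a (p + r - int i) (prd b (q + int i) c)
            - scale ((-1) powi r) (prd b (q + r - int i) (prd a (p + int i) c))))"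
begin

lemma eventually_prd_zero: "\<exists>N::nat. \<forall>i\<ge>N. prd a (r + int i) b = 0"
proof -
  obtain M where M: "\<forall>n\<ge>M. prd a n b = 0" using truncation by blast
  show ?thesis by (rule exI[of _ "nat (M - r)"]) (use M in auto)
qed

lemma prd_zero_left [simp]: "prd 0 n b = 0"
proof -
  interpret l: Vector_Spaces.linear scale scale "\<lambda>a. prd a n b" by (rule linear_left)
  show ?thesis by (rule l.zero)
qed

lemma prd_zero_right [simp]: "prd a n 0 = 0"
proof -
  interpret l: Vector_Spaces.linear scale scale "\<lambda>b. prd a n b" by (rule linear_right)
  show ?thesis by (rule l.zero)
qed

lemma finite_support_borcherds_left:
  "finite {i::nat. scale (of_int p gchoose i)
     (prd (prd a (r + int i) b) (p + q - int i) c) \<noteq> 0}"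
proof -
  obtain N where N: "\<forall>i\<ge>N. prd a (r + int i) b = 0" using eventually_prd_zero by blast
  show ?thesis
    by (rule finite_subset[of _ "{..<N}"]) (use N in \<open>auto simp: not_less[symmetric]\<close>)
qed

lemma finite_support_borcherds_right:
  "finite {i::nat. scale ((-1) ^ i * (of_int r gchoose i))
     (prd a (p + r - int i) (prd b (q + int i) c)
       - scale ((-1) powi r) (prd b (q + r - int i) (prd a (p + int i) c))) \<noteq> 0}"
proof -
  obtain N where N: "\<forall>i\<ge>N. prd b (q + int i) c = 0" using eventually_prd_zero by blast
  obtain M where M: "\<forall>i\<ge>M. prd a (p + int i) c = 0" using eventually_prd_zero by blast
  show ?thesis
  proof (rule finite_subset[of _ "{..<max N M}"])
    show "{i::nat. scale ((-1) ^ i * (of_int r gchoose i))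
     (prd a (p + r - int i) (prd b (q + int i) c)
       - scale ((-1) powi r) (prd b (q + r - int i) (prd a (p + int i) c))) \<noteq> 0} \<subseteq> {..<max N M}"
    proof (rule subsetI, rule ccontr)
      fix i assume i: "i \<in> {i::nat. scale ((-1) ^ i * (of_int r gchoose i))
        (prd a (p + r - int i) (prd b (q + int i) c)
          - scale ((-1) powi r) (prd b (q + r - int i) (prd a (p + int i) c))) \<noteq> 0}"
        and "i \<notin> {..<max N M}"
      then have "prd b (q + int i) c = 0" "prd a (p + int i) c = 0" using N M by auto
      with i show False by simp
    qed
  qed simp
qed

end

definition decomposes_as :: "(int \<Rightarrow> 'v::ab_group_add set) \<Rightarrow> 'v \<Rightarrow> (int \<Rightarrow> 'v) \<Rightarrow> bool" where
  "decomposes_as V v f \<longleftrightarrow> (\<forall>n. f n \<in> V n) \<and> finite {n. f n \<noteq> 0} \<and> v = Sum_any f"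

definition direct_sum_decomposition ::
    "('k::field_char_0 \<Rightarrow> 'v::ab_group_add \<Rightarrow> 'v) \<Rightarrow> (int \<Rightarrow> 'v set) \<Rightarrow> bool" where
  "direct_sum_decomposition scale V \<longleftrightarrow>
     (\<forall>n. module.subspace scale (V n)) \<and> (\<forall>v. \<exists>!f. decomposes_as V v f)"

text \<open>The canonical projection onto \<open>V n\<close>; meaningful for a direct sum decomposition.\<close>

definition pr :: "(int \<Rightarrow> 'v::ab_group_add set) \<Rightarrow> int \<Rightarrow> 'v \<Rightarrow> 'v" where
  "pr V n v = (THE f. decomposes_as V v f) n"

text \<open>The internal sum of the \<open>V i\<close> with \<open>i \<ge> n\<close>.\<close>

definition graded_ge ::
    "('k::field_char_0 \<Rightarrow> 'v::ab_group_add \<Rightarrow> 'v) \<Rightarrow> (int \<Rightarrow> 'v set) \<Rightarrow> int \<Rightarrow> 'v set" where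
  "graded_ge scale V n = module.span scale (\<Union>i\<in>{n..}. V i)"

locale graded_vertex_algebra = vertex_algebra scale vac prd
  for scale :: "'k::field_char_0 \<Rightarrow> 'v::ab_group_add \<Rightarrow> 'v"
    and vac :: 'v
    and prd :: "'v \<Rightarrow> int \<Rightarrow> 'v \<Rightarrow> 'v" +
  fixes V :: "int \<Rightarrow> 'v set"
  assumes direct_sum: "direct_sum_decomposition scale V"
    and prd_graded: "a \<in> V n \<Longrightarrow> b \<in> V m \<Longrightarrow> prd a k b \<in> V (n + m - k - 1)"
    and vac_graded: "vac \<in> V 0"

definition va_endomorphism ::
    "('k::field_char_0 \<Rightarrow> 'v::ab_group_add \<Rightarrow> 'v) \<Rightarrow> 'v \<Rightarrow> ('v \<Rightarrow> int \<Rightarrow> 'v \<Rightarrow> 'v) \<Rightarrow> ('v \<Rightarrow> 'v) \<Rightarrow> bool" where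
  "va_endomorphism scale vac prd f \<longleftrightarrow>
     Vector_Spaces.linear scale scale f \<and>
     (\<forall>a n b. f (prd a n b) = prd (f a) n (f b)) \<and> f vac = vac"

definition va_Aut ::
    "('k::field_char_0 \<Rightarrow> 'v::ab_group_add \<Rightarrow> 'v) \<Rightarrow> 'v \<Rightarrow> ('v \<Rightarrow> int \<Rightarrow> 'v \<Rightarrow> 'v) \<Rightarrow> ('v \<Rightarrow> 'v) set" where
  "va_Aut scale vac prd = {f. va_endomorphism scale vac prd f \<and> bij f}"

definition va_Aut_plus ::
    "('k::field_char_0 \<Rightarrow> 'v::ab_group_add \<Rightarrow> 'v) \<Rightarrow> 'v \<Rightarrow> ('v \<Rightarrow> int \<Rightarrow> 'v \<Rightarrow> 'v) \<Rightarrow>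
     (int \<Rightarrow> 'v set) \<Rightarrow> ('v \<Rightarrow> 'v) set" where
  "va_Aut_plus scale vac prd V =
     {f \<in> va_Aut scale vac prd. \<forall>n. f ` V n \<subseteq> graded_ge scale V n \<and> (\<forall>v\<in>V n. pr V n (f v) = v)}"

end

theory Submission
  imports Defs
begin

text \<open>Let \<open>\<psi>\<close> send a \<open>V'\<close>-homogeneous vector \<open>v \<in> V' n\<close> to its component \<open>pr V n v\<close>, and extend
  linearly.  Since \<open>V' n \<subseteq> V\<^sub>\<ge>\<^sub>n\<close>, this is the leading (lowest, possibly zero)
  component of \<open>v\<close> for the grading \<open>V\<close>.
  The product \<open>a(k)b\<close> has degree \<open>n + m - k - 1\<close> for both gradings when \<open>a\<close> and \<open>b\<close> have degrees
  \<open>n\<close> and \<open>m\<close>, and the leading component of a product is the product of the leading components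
  (\<open>pr_prd_graded_ge\<close>); so \<open>\<psi>\<close> is an endomorphism (\<open>lead_map_endomorphism\<close>), and it maps
  \<open>V' n\<close> into \<open>V n\<close> by construction.

  If the inclusions hold in both directions, the two filtrations \<open>V\<^sub>\<ge>\<^sub>n\<close> and \<open>V'\<^sub>\<ge>\<^sub>n\<close> coincide, and the
  same construction with the roles exchanged gives an endomorphism \<open>\<phi>\<close> with \<open>\<phi> (V n) \<subseteq> V' n\<close>.
  For \<open>v \<in> V n\<close> the difference \<open>v - \<phi> v\<close> lies in \<open>V'\<^bsub>\<ge>n+1\<^esub> = V\<^bsub>\<ge>n+1\<^esub>\<close>, hence \<open>pr V n (\<phi> v) = v\<close>.
  Together with the same statement for the exchanged gradings, this shows that \<open>\<psi>\<close> and \<open>\<phi>\<close> are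
  mutually inverse, so that \<open>\<phi> (V n) = V' n \<subseteq> V\<^sub>\<ge>\<^sub>n\<close>, and \<open>\<phi>\<close> is the required element of
  \<open>va_Aut_plus\<close>.\<close>

section \<open>Linear maps on finite sums and on spans\<close>

context vector_space
begin

lemma linear_Sum_any:
  assumes f: "Vector_Spaces.linear scale scale f" and fin: "finite {i. g i \<noteq> 0}"
  shows "f (Sum_any g) = Sum_any (\<lambda>i. f (g i))"
proof -
  interpret f: Vector_Spaces.linear scale scale f by (rule f)
  have "{i. f (g i) \<noteq> 0} \<subseteq> {i. g i \<noteq> 0}" by (auto simp: f.zero)
  with fin have "Sum_any (\<lambda>i. f (g i)) = (\<Sum>i | g i \<noteq> 0. f (g i))"
    by (rule Sum_any.expand_superset)
  also have "\<dots> = f (Sum_any g)" by (simp only: Sum_any.expand_set f.sum)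
  finally show ?thesis by simp
qed

lemma bilinear_eq_on_span:
  assumes "\<And>b. Vector_Spaces.linear scale scale (\<lambda>a. f a b)"
    and "\<And>a. Vector_Spaces.linear scale scale (f a)"
    and "\<And>b. Vector_Spaces.linear scale scale (\<lambda>a. g a b)"
    and "\<And>a. Vector_Spaces.linear scale scale (g a)"
    and eq: "\<And>a b. a \<in> S \<Longrightarrow> b \<in> T \<Longrightarrow> f a b = g a b"
    and a: "a \<in> span S" and b: "b \<in> span T"
  shows "f a b = g a b"
proof -
  interpret vector_space_pair scale scale by unfold_locales
  have "f a b = g a b" if "b \<in> T" for b
    using linear_eq_on_span[OF assms(1) assms(3) eq[OF _ that] a] .
  then show ?thesis using linear_eq_on_span[OF assms(2) assms(4) _ b] by blast
qed

end

section \<open>Projections of a graded vector space\<close>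

text \<open>A vector space, on the whole type, that is the internal direct sum of the subspaces \<open>V n\<close>.\<close>

locale graded_space = vector_space scale
  for scale :: "'k::field_char_0 \<Rightarrow> 'v::ab_group_add \<Rightarrow> 'v" +
  fixes V :: "int \<Rightarrow> 'v set"
  assumes decomposition: "direct_sum_decomposition scale V"
begin

lemma subspace_component: "subspace (V n)"
  using decomposition by (simp add: direct_sum_decomposition_def)

lemma pr_unique: "decomposes_as V v f \<Longrightarrow> pr V n v = f n"
  using decomposition unfolding direct_sum_decomposition_def pr_def
  by (metis (mono_tags, lifting) the1_equality)

lemma decomposes_pr: "decomposes_as V v (\<lambda>n. pr V n v)"
proof -
  obtain f where f: "decomposes_as V v f"
    using decomposition unfolding direct_sum_decomposition_def by blast
  moreover from f have "(\<lambda>n. pr V n v) = f" by (auto simp: pr_unique)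
  ultimately show ?thesis by simp
qed

lemma pr_mem: "pr V n v \<in> V n"
  and finite_pr: "finite {n. pr V n v \<noteq> 0}"
  and Sum_any_pr: "Sum_any (\<lambda>n. pr V n v) = v"
  using decomposes_pr[of v] by (auto simp: decomposes_as_def)

lemma linear_pr: "Vector_Spaces.linear scale scale (pr V n)"
proof -
  have "pr V n (v + w) = pr V n v + pr V n w" for v w
  proof (rule pr_unique)
    show "decomposes_as V (v + w) (\<lambda>n. pr V n v + pr V n w)"
      unfolding decomposes_as_def
    proof (intro conjI allI)
      show "finite {n. pr V n v + pr V n w \<noteq> 0}"
        by (rule finite_subset[OF _ finite_UnI[OF finite_pr[of v] finite_pr[of w]]]) auto
    qed (simp_all add: Sum_any.distrib finite_pr Sum_any_pr
          subspace_add[OF subspace_component] pr_mem)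
  qed
  moreover have "pr V n (scale c v) = scale c (pr V n v)" for c v
  proof (rule pr_unique)
    have "finite {n. scale c (pr V n v) \<noteq> 0}"
      by (rule finite_subset[OF _ finite_pr[of v]]) auto
    then show "decomposes_as V (scale c v) (\<lambda>n. scale c (pr V n v))"
      unfolding decomposes_as_def
      using linear_Sum_any[OF linear_scale_self finite_pr[of v]]
      by (auto simp: Sum_any_pr intro: subspace_scale[OF subspace_component] pr_mem)
  qed
  ultimately show ?thesis by unfold_locales
qed

lemma pr_homogeneous: "v \<in> V m \<Longrightarrow> pr V n v = (if n = m then v else 0)"
  by (rule pr_unique) (auto simp: decomposes_as_def subspace_0[OF subspace_component])

lemma pr_zero: "pr V n 0 = 0"
  using pr_homogeneous[OF subspace_0[OF subspace_component]] by simp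

lemma span_homogeneous: "span (\<Union>n. V n) = UNIV"
proof -
  have "v \<in> span (\<Union>n. V n)" for v
  proof -
    have "v = (\<Sum>n | pr V n v \<noteq> 0. pr V n v)"
      using Sum_any_pr[of v] by (simp only: Sum_any.expand_set)
    also have "\<dots> \<in> span (\<Union>n. V n)"
      by (intro span_sum span_base) (use pr_mem in blast)
    finally show ?thesis .
  qed
  then show ?thesis by blast
qed

lemma linear_eq_on_homogeneous:
  assumes "Vector_Spaces.linear scale scale f" "Vector_Spaces.linear scale scale g"
    and "\<And>n v. v \<in> V n \<Longrightarrow> f v = g v"
  shows "f v = g v"
proof -
  interpret vector_space_pair scale scale by unfold_locales
  show ?thesis
    by (rule linear_eq_on_span[OF assms(1,2), of "\<Union>n. V n"]) (auto simp: assms(3) span_homogeneous)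
qed

lemma graded_ge_iff: "v \<in> graded_ge scale V n \<longleftrightarrow> (\<forall>i<n. pr V i v = 0)"
proof
  assume v: "v \<in> graded_ge scale V n"
  show "\<forall>i<n. pr V i v = 0"
  proof (intro allI impI)
    fix i assume "i < n"
    interpret p: Vector_Spaces.linear scale scale "pr V i" by (rule linear_pr)
    show "pr V i v = 0"
      by (rule p.eq_0_on_span[OF _ v[unfolded graded_ge_def]])
        (use \<open>i < n\<close> in \<open>auto simp: pr_homogeneous\<close>)
  qed
next
  assume low: "\<forall>i<n. pr V i v = 0"
  have "v = (\<Sum>i | pr V i v \<noteq> 0. pr V i v)"
    using Sum_any_pr[of v] by (simp only: Sum_any.expand_set)
  also have "\<dots> \<in> span (\<Union>i\<in>{n..}. V i)"
  proof (intro span_sum span_base)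
    fix i assume "i \<in> {i. pr V i v \<noteq> 0}"
    then have "i \<ge> n" using low not_less by blast
    then show "pr V i v \<in> (\<Union>i\<in>{n..}. V i)" using pr_mem by blast
  qed
  finally show "v \<in> graded_ge scale V n" by (simp add: graded_ge_def)
qed

lemma diff_pr_graded_ge:
  assumes "v \<in> graded_ge scale V n"
  shows "v - pr V n v \<in> graded_ge scale V (n + 1)"
proof -
  have "pr V i (v - pr V n v) = 0" if "i < n + 1" for i
  proof -
    interpret p: Vector_Spaces.linear scale scale "pr V i" by (rule linear_pr)
    have "pr V i (pr V n v) = (if i = n then pr V n v else 0)" by (rule pr_homogeneous[OF pr_mem])
    then show ?thesis using assms that by (auto simp: p.diff graded_ge_iff)
  qed
  then show ?thesis by (simp add: graded_ge_iff)
qed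

end

lemma graded_ge_mono:
  assumes "vector_space scale" and "\<And>i. V i \<subseteq> graded_ge scale W i"
  shows "graded_ge scale V n \<subseteq> graded_ge scale W n"
proof -
  interpret vector_space scale by fact
  have "V i \<subseteq> graded_ge scale W n" if "i \<ge> n" for i
  proof -
    have "graded_ge scale W i \<subseteq> graded_ge scale W n"
      unfolding graded_ge_def by (rule span_mono) (use that in force)
    with assms(2) show ?thesis by blast
  qed
  then show ?thesis
    unfolding graded_ge_def[of scale V]
    by (intro span_minimal) (auto simp: graded_ge_def)
qed

section \<open>The leading component map\<close>

text \<open>For two gradings \<open>V\<close> and \<open>W\<close>, the linear map that sends a vector of \<open>W n\<close> to its component in
  \<open>V n\<close>, for all \<open>n\<close>; the sum below is over a finite support because \<open>v\<close> has only finitely many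
  components for \<open>W\<close>.  When \<open>W n \<subseteq> graded_ge scale V n\<close>, it takes the lowest component, in degree \<open>n\<close> and
  possibly zero, of each vector of \<open>W n\<close>.\<close>

definition lead_map :: "(int \<Rightarrow> 'v::ab_group_add set) \<Rightarrow> (int \<Rightarrow> 'v set) \<Rightarrow> 'v \<Rightarrow> 'v" where
  "lead_map V W v = Sum_any (\<lambda>n. pr V n (pr W n v))"

text \<open>Two gradings of the same vector space; no compatibility between them is assumed.\<close>

locale bigraded_space = graded_space scale V + W: graded_space scale W
  for scale :: "'k::field_char_0 \<Rightarrow> 'v::ab_group_add \<Rightarrow> 'v" and V W :: "int \<Rightarrow> 'v set"
begin

lemma linear_pr_pr: "Vector_Spaces.linear scale scale (\<lambda>v. pr V n (pr W n v))"
  using Vector_Spaces.linear_compose[OF W.linear_pr linear_pr] by (simp add: o_def)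

lemma finite_pr_pr: "finite {n. pr V n (pr W n v) \<noteq> 0}"
proof (rule finite_subset[OF _ W.finite_pr[of v]])
  show "{n. pr V n (pr W n v) \<noteq> 0} \<subseteq> {n. pr W n v \<noteq> 0}" by (auto simp: pr_zero)
qed

lemma linear_lead_map: "Vector_Spaces.linear scale scale (lead_map V W)"
proof -
  have add: "pr V n (pr W n (v + w)) = pr V n (pr W n v) + pr V n (pr W n w)"
    and sc: "pr V n (pr W n (scale c v)) = scale c (pr V n (pr W n v))" for n v w c
  proof -
    interpret p: Vector_Spaces.linear scale scale "\<lambda>v. pr V n (pr W n v)" by (rule linear_pr_pr)
    show "pr V n (pr W n (v + w)) = pr V n (pr W n v) + pr V n (pr W n w)" by (rule p.add)
    show "pr V n (pr W n (scale c v)) = scale c (pr V n (pr W n v))" by (rule p.scale)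
  qed
  show ?thesis
    by unfold_locales
      (simp_all add: lead_map_def add sc Sum_any.distrib finite_pr_pr
        linear_Sum_any[OF linear_scale_self finite_pr_pr])
qed

lemma lead_map_homogeneous:
  assumes "v \<in> W n"
  shows "lead_map V W v = pr V n v"
proof -
  have "pr V i (pr W i v) = (if i = n then pr V n v else 0)" for i
    using W.pr_homogeneous[OF assms, of i] by (auto simp: pr_zero)
  then show ?thesis by (simp add: lead_map_def)
qed

lemma lead_map_mem: "v \<in> W n \<Longrightarrow> lead_map V W v \<in> V n"
  by (simp add: lead_map_homogeneous pr_mem)

end

text \<open>When the two filtrations coincide, projecting a vector of \<open>V n\<close> to \<open>W n\<close> changes it only in
  degrees greater than \<open>n\<close>.\<close>

lemma (in bigraded_space) pr_pr_homogeneous: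
  assumes WV: "\<And>n. W n \<subseteq> graded_ge scale V n" and VW: "\<And>n. V n \<subseteq> graded_ge scale W n"
    and v: "v \<in> V n"
  shows "pr V n (pr W n v) = v"
proof -
  interpret p: Vector_Spaces.linear scale scale "pr V n" by (rule linear_pr)
  have "v - pr W n v \<in> graded_ge scale W (n + 1)"
    using VW v by (blast intro: W.diff_pr_graded_ge)
  also have "\<dots> \<subseteq> graded_ge scale V (n + 1)"
    by (rule graded_ge_mono[OF vector_space_axioms WV])
  finally have "pr V n (v - pr W n v) = 0" by (simp add: graded_ge_iff)
  then show ?thesis using pr_homogeneous[OF v, of n] by (simp add: p.diff)
qed

lemma lead_map_inverse:
  assumes VW: "bigraded_space scale V W"
    and "\<And>n. W n \<subseteq> graded_ge scale V n" and "\<And>n. V n \<subseteq> graded_ge scale W n"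
  shows "lead_map V W (lead_map W V v) = v"
proof -
  interpret bigraded_space scale V W by (rule VW)
  interpret opp: bigraded_space scale W V by unfold_locales
  have "(lead_map V W \<circ> lead_map W V) v = id v"
  proof (rule linear_eq_on_homogeneous[where f = "lead_map V W \<circ> lead_map W V" and g = id])
    show "Vector_Spaces.linear scale scale (lead_map V W \<circ> lead_map W V)"
      by (rule Vector_Spaces.linear_compose[OF opp.linear_lead_map linear_lead_map])
    show "Vector_Spaces.linear scale scale id" by (rule linear_id)
    show "(lead_map V W \<circ> lead_map W V) v = id v" if "v \<in> V n" for n v
      using pr_pr_homogeneous[OF assms(2,3) that]
      by (simp add: opp.lead_map_homogeneous[OF that] lead_map_homogeneous[OF W.pr_mem])
  qed
  then show ?thesis by simp
qed

section \<open>Compatibility with the vertex algebra structure\<close>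

sublocale graded_vertex_algebra \<subseteq> graded_space scale V
  by unfold_locales (rule direct_sum)

context graded_vertex_algebra
begin

text \<open>The leading component of a product is the product of the leading components: a summand
  \<open>a i (k) b j\<close> with \<open>i \<ge> n\<close> and \<open>j \<ge> m\<close> has the lowest degree \<open>n + m - k - 1\<close> only for
  \<open>i = n\<close> and \<open>j = m\<close>.\<close>

lemma pr_prd_graded_ge:
  assumes "a \<in> graded_ge scale V n" and "b \<in> graded_ge scale V m"
  shows "pr V (n + m - k - 1) (prd a k b) = prd (pr V n a) k (pr V m b)"
proof (rule bilinear_eq_on_span[where f = "\<lambda>a b. pr V (n + m - k - 1) (prd a k b)"
      and g = "\<lambda>a b. prd (pr V n a) k (pr V m b)"])
  show "a \<in> span (\<Union>i\<in>{n..}. V i)" "b \<in> span (\<Union>i\<in>{m..}. V i)"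
    using assms by (simp_all add: graded_ge_def)
  show "pr V (n + m - k - 1) (prd a k b) = prd (pr V n a) k (pr V m b)"
    if "a \<in> (\<Union>i\<in>{n..}. V i)" "b \<in> (\<Union>i\<in>{m..}. V i)" for a b
  proof -
    from that obtain i j where ij: "i \<ge> n" "j \<ge> m" and a: "a \<in> V i" and b: "b \<in> V j" by auto
    from ij have "n + m - k - 1 = i + j - k - 1 \<longleftrightarrow> n = i \<and> m = j" by auto
    then show ?thesis
      by (auto simp: pr_homogeneous[OF a] pr_homogeneous[OF b] pr_homogeneous[OF prd_graded[OF a b]])
  qed
  show "Vector_Spaces.linear scale scale (\<lambda>a. pr V (n + m - k - 1) (prd a k b))" for b
    using Vector_Spaces.linear_compose[OF linear_left linear_pr] by (simp add: o_def)
  show "Vector_Spaces.linear scale scale (\<lambda>b. pr V (n + m - k - 1) (prd a k b))" for a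
    using Vector_Spaces.linear_compose[OF linear_right linear_pr] by (simp add: o_def)
  show "Vector_Spaces.linear scale scale (\<lambda>a. prd (pr V n a) k (pr V m b))" for b
    using Vector_Spaces.linear_compose[OF linear_pr linear_left] by (simp add: o_def)
  show "Vector_Spaces.linear scale scale (\<lambda>b. prd (pr V n a) k (pr V m b))" for a
    using Vector_Spaces.linear_compose[OF linear_pr linear_right] by (simp add: o_def)
qed

end

lemma lead_map_endomorphism:
  assumes V: "graded_vertex_algebra scale vac prd V" and W: "graded_vertex_algebra scale vac prd W"
    and WV: "\<And>n. W n \<subseteq> graded_ge scale V n"
  shows "va_endomorphism scale vac prd (lead_map V W)"
proof -
  interpret graded_vertex_algebra scale vac prd V by (rule V)
  interpret W: graded_vertex_algebra scale vac prd W by (rule W)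
  interpret bigraded_space scale V W by unfold_locales
  let ?\<psi> = "lead_map V W"
  have "?\<psi> (prd a k b) = prd (?\<psi> a) k (?\<psi> b)" for a k b
  proof (rule bilinear_eq_on_span[where f = "\<lambda>a b. ?\<psi> (prd a k b)"
        and g = "\<lambda>a b. prd (?\<psi> a) k (?\<psi> b)"])
    show "a \<in> span (\<Union>n. W n)" "b \<in> span (\<Union>n. W n)" by (simp_all add: W.span_homogeneous)
    show "?\<psi> (prd a k b) = prd (?\<psi> a) k (?\<psi> b)" if "a \<in> (\<Union>n. W n)" "b \<in> (\<Union>n. W n)" for a b
    proof -
      from that obtain n m where a: "a \<in> W n" and b: "b \<in> W m" by auto
      then have "a \<in> graded_ge scale V n" "b \<in> graded_ge scale V m" using WV by auto
      then show ?thesis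
        by (simp add: lead_map_homogeneous[OF a] lead_map_homogeneous[OF b]
            lead_map_homogeneous[OF W.prd_graded[OF a b]] pr_prd_graded_ge)
    qed
    show "Vector_Spaces.linear scale scale (\<lambda>a. ?\<psi> (prd a k b))" for b
      using Vector_Spaces.linear_compose[OF linear_left linear_lead_map] by (simp add: o_def)
    show "Vector_Spaces.linear scale scale (\<lambda>b. ?\<psi> (prd a k b))" for a
      using Vector_Spaces.linear_compose[OF linear_right linear_lead_map] by (simp add: o_def)
    show "Vector_Spaces.linear scale scale (\<lambda>a. prd (?\<psi> a) k (?\<psi> b))" for b
      using Vector_Spaces.linear_compose[OF linear_lead_map linear_left] by (simp add: o_def)
    show "Vector_Spaces.linear scale scale (\<lambda>b. prd (?\<psi> a) k (?\<psi> b))" for a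
      using Vector_Spaces.linear_compose[OF linear_lead_map linear_right] by (simp add: o_def)
  qed
  moreover have "?\<psi> vac = vac"
    using lead_map_homogeneous[OF W.vac_graded] pr_homogeneous[OF vac_graded, of 0] by simp
  ultimately show ?thesis by (simp add: va_endomorphism_def linear_lead_map)
qed

section \<open>Comparison of two gradings of a vertex algebra\<close>

theorem lemma3p3:
  fixes scale :: "'k::field_char_0 \<Rightarrow> 'v::ab_group_add \<Rightarrow> 'v"
    and vac :: 'v
    and prd :: "'v \<Rightarrow> int \<Rightarrow> 'v \<Rightarrow> 'v"
    and V V' :: "int \<Rightarrow> 'v set"
  assumes base_field: "real_or_complex TYPE('k)"
    and V: "graded_vertex_algebra scale vac prd V"
    and V': "graded_vertex_algebra scale vac prd V'"
  shows "((\<forall>n. V' n \<subseteq> graded_ge scale V n) \<longrightarrow>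
            (\<exists>\<psi>. va_endomorphism scale vac prd \<psi> \<and> (\<forall>n. \<psi> ` V' n \<subseteq> V n))) \<and>
         ((\<forall>n. V' n \<subseteq> graded_ge scale V n) \<and> (\<forall>n. V n \<subseteq> graded_ge scale V' n) \<longrightarrow>
            (\<exists>\<psi>\<in>va_Aut_plus scale vac prd V. \<forall>n. \<psi> ` V n = V' n))"
proof -
  interpret V: graded_vertex_algebra scale vac prd V by (rule V)
  interpret V': graded_vertex_algebra scale vac prd V' by (rule V')
  interpret VV': bigraded_space scale V V' by unfold_locales
  interpret V'V: bigraded_space scale V' V by unfold_locales
  have "\<exists>\<psi>. va_endomorphism scale vac prd \<psi> \<and> (\<forall>n. \<psi> ` V' n \<subseteq> V n)"
    if "\<And>n. V' n \<subseteq> graded_ge scale V n"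
    using lead_map_endomorphism[OF V V' that] VV'.lead_map_mem by blast
  moreover have "\<exists>\<psi>\<in>va_Aut_plus scale vac prd V. \<forall>n. \<psi> ` V n = V' n"
    if V'_ge: "\<And>n. V' n \<subseteq> graded_ge scale V n" and V_ge: "\<And>n. V n \<subseteq> graded_ge scale V' n"
  proof -
    let ?\<phi> = "lead_map V' V" and ?\<psi> = "lead_map V V'"
    have \<psi>\<phi>: "?\<psi> (?\<phi> v) = v" and \<phi>\<psi>: "?\<phi> (?\<psi> v) = v" for v
      using lead_map_inverse[OF VV'.bigraded_space_axioms V'_ge V_ge]
        lead_map_inverse[OF V'V.bigraded_space_axioms V_ge V'_ge] by auto
    have "bij ?\<phi>" by (rule bij_betw_byWitness[of _ ?\<psi>]) (auto simp: \<psi>\<phi> \<phi>\<psi>)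
    have image: "?\<phi> ` V n = V' n" for n
    proof
      show "?\<phi> ` V n \<subseteq> V' n" using V'V.lead_map_mem by blast
      show "V' n \<subseteq> ?\<phi> ` V n"
      proof
        fix v assume "v \<in> V' n"
        then have "?\<psi> v \<in> V n" by (rule VV'.lead_map_mem)
        then show "v \<in> ?\<phi> ` V n" by (rule rev_image_eqI) (simp add: \<phi>\<psi>)
      qed
    qed
    have "pr V n (?\<phi> v) = v" if "v \<in> V n" for n v
      using VV'.pr_pr_homogeneous[OF V'_ge V_ge that] by (simp only: V'V.lead_map_homogeneous[OF that])
    moreover have "?\<phi> ` V n \<subseteq> graded_ge scale V n" for n
      using V'_ge by (simp only: image)
    ultimately have "?\<phi> \<in> va_Aut_plus scale vac prd V"
      using lead_map_endomorphism[OF V' V V_ge] \<open>bij ?\<phi>\<close>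
      unfolding va_Aut_plus_def va_Aut_def by blast
    with image show ?thesis by blast
  qed
  ultimately show ?thesis by blast
qed

end
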